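(* Let $Q\in\mathbb{R}^{n\times n}$ be symmetric with $\lambda_{\min}(Q)<0$, let $c,a_1,\ldots,a_m\in\mathbb{R}^n$ and $b_1,\ldots,b_m\in\mathbb{R}$. If $$[{\rm NewDC}]\qquad {\rm rank}\left([Q-\lambda_{\min}(Q)I_n\ \ a_1\ \ldots\ a_m]\right)\le n-1,$$ then $v({\rm T_m})=v({\rm P})$. Moreover, the condition $[{\rm NewDC}]$ is more general than the condition $$[{\rm DC}]\qquad {\rm dim\,Ker}(Q-\lambda_{\min}(Q)I_n)\ge {\rm dim\,span}\{a_1,\ldots,a_m\}+1,$$ i.e. $[{\rm DC}]$ implies $[{\rm NewDC}]$.
   Context: $\lambda_{\min}(Q)$ is the smallest eigenvalue of $Q$, $I_n$ is the $n\times n$ identity matrix, and $[Q-\lambda_{\min}(Q)I_n\ a_1\ \ldots\ a_m]$ is the $n\times(n+m)$ matrix obtained by appending the columns $a_1,\ldots,a_m$. $({\rm T_m})$ is the extended trust region subproblem $$\min_{x\in\mathbb{R}^n}\ \tfrac12x^TQx+c^Tx\quad\text{s.t.}\quad x^Tx\le1,\quad a_i^Tx\le b_i,\ i=1,\ldots,m.$$ $({\rm P})$ is its standard SDP relaxation, in the variables $x\in\mathbb{R}^n$ and $X$ a symmetric $n\times n$ real matrix: $$\min\ \tfrac12{\rm trace}(QX)+c^Tx\quad\text{s.t.}\quad {\rm trace}(X)\le1,\quad a_i^Tx\le b_i,\ i=1,\ldots,m,\quad \begin{pmatrix} X & x \\ {x}^T & 1 \end{pmatrix}\succeq0.$$ $v(\cdot)$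 denotes the optimal value (infimum) of a problem, with value $+\infty$ if the problem is infeasible. *)

theory Defs
  imports
    "Jordan_Normal_Form.Char_Poly"
    "Jordan_Normal_Form.DL_Rank"
    "Jordan_Normal_Form.Matrix_Kernel"
    "HOL-Library.Extended_Real"
begin

text \<open>Vectors and matrices have explicit dimensions. The vectors
  \<open>a\<^sub>1, \<dots>, a\<^sub>m\<close> and the numbers \<open>b\<^sub>1, \<dots>, b\<^sub>m\<close> are the values of functions on
  \<open>{1..m}\<close>; other values play no role. The case \<open>m = 0\<close> is included.\<close>

text \<open>Only meaningful when \<open>Q\<close> has a real eigenvalue, for example when \<open>Q\<close> is symmetric of
  dimension at least one.\<close>

definition lambda_min :: "real mat \<Rightarrow> real" where
  "lambda_min Q = Min {k. eigenvalue Q k}"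

definition mat_trace :: "real mat \<Rightarrow> real" where
  "mat_trace A = (\<Sum>i<dim_row A. A $$ (i, i))"

definition pos_semidef :: "real mat \<Rightarrow> bool" where
  "pos_semidef A \<longleftrightarrow> square_mat A \<and> A\<^sup>T = A \<and>
     (\<forall>y \<in> carrier_vec (dim_row A). 0 \<le> y \<bullet> (A *\<^sub>v y))"

definition shifted_mat :: "nat \<Rightarrow> real mat \<Rightarrow> real mat" where
  "shifted_mat n Q = Q - lambda_min Q \<cdot>\<^sub>m 1\<^sub>m n"

definition (in vec_space) span_dim :: "'a vec set \<Rightarrow> nat" where
  "span_dim S = vectorspace.dim class_ring (span_vs S)"

definition tr_feasible :: "nat \<Rightarrow> nat \<Rightarrow> (nat \<Rightarrow> real vec) \<Rightarrow> (nat \<Rightarrow> real) \<Rightarrow> real vec set" where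
  "tr_feasible n m a b =
     {x \<in> carrier_vec n. x \<bullet> x \<le> 1 \<and> (\<forall>i\<in>{1..m}. a i \<bullet> x \<le> b i)}"

text \<open>The infimum of the empty set in \<^typ>\<open>ereal\<close> is \<open>\<infinity>\<close>, as required for infeasible
  problems.\<close>

definition tr_value ::
  "nat \<Rightarrow> nat \<Rightarrow> real mat \<Rightarrow> real vec \<Rightarrow> (nat \<Rightarrow> real vec) \<Rightarrow> (nat \<Rightarrow> real) \<Rightarrow> ereal" where
  "tr_value n m Q c a b =
     (INF x\<in>tr_feasible n m a b. ereal (1 / 2 * (x \<bullet> (Q *\<^sub>v x)) + c \<bullet> x))"

definition bordered_mat :: "nat \<Rightarrow> real mat \<Rightarrow> real vec \<Rightarrow> real mat" where
  "bordered_mat n X x = four_block_mat X (mat_of_cols n [x]) (mat_of_rows n [x]) (1\<^sub>m 1)"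

definition sdp_feasible ::
  "nat \<Rightarrow> nat \<Rightarrow> (nat \<Rightarrow> real vec) \<Rightarrow> (nat \<Rightarrow> real) \<Rightarrow> (real vec \<times> real mat) set" where
  "sdp_feasible n m a b =
     {(x, X). x \<in> carrier_vec n \<and> X \<in> carrier_mat n n \<and> X\<^sup>T = X \<and>
        mat_trace X \<le> 1 \<and> (\<forall>i\<in>{1..m}. a i \<bullet> x \<le> b i) \<and>
        pos_semidef (bordered_mat n X x)}"

definition sdp_value ::
  "nat \<Rightarrow> nat \<Rightarrow> real mat \<Rightarrow> real vec \<Rightarrow> (nat \<Rightarrow> real vec) \<Rightarrow> (nat \<Rightarrow> real) \<Rightarrow> ereal" where
  "sdp_value n m Q c a b =
     (INF (x, X)\<in>sdp_feasible n m a b. ereal (1 / 2 * mat_trace (Q * X) + c \<bullet> x))"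

definition NewDC :: "nat \<Rightarrow> nat \<Rightarrow> real mat \<Rightarrow> (nat \<Rightarrow> real vec) \<Rightarrow> bool" where
  "NewDC n m Q a \<longleftrightarrow>
     vec_space.rank n (mat_of_cols n (cols (shifted_mat n Q) @ map a [1..<Suc m])) \<le> n - 1"

definition DC :: "nat \<Rightarrow> nat \<Rightarrow> real mat \<Rightarrow> (nat \<Rightarrow> real vec) \<Rightarrow> bool" where
  "DC n m Q a \<longleftrightarrow>
     kernel_dim (shifted_mat n Q) \<ge> vec_space.span_dim n (a ` {1..m}) + 1"

end

theory Submission
  imports Defs
begin

text \<open>
  The columns of \<open>[Q - \<lambda>I a\<^sub>1 \<dots> a\<^sub>m]\<close>, where \<open>\<lambda> = \<lambda>\<^sub>m\<^sub>i\<^sub>n(Q)\<close>, span a proper subspace of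
  \<open>\<real>\<^sup>n\<close> exactly when some \<open>z \<noteq> 0\<close> is orthogonal to all of them. As \<open>Q\<close> is symmetric, this says
  that \<open>z\<close> is an eigenvector for \<open>\<lambda>\<close> along which no linear constraint changes
  (\<open>NewDC_iff_common_null_vector\<close>). Such a direction closes the relaxation gap.

  Let \<open>(x, X)\<close> be feasible for the relaxation. The Schur complement \<open>Y = X - xx\<^sup>T\<close> of the bordered
  matrix is positive semidefinite with trace at most \<open>1 - x\<^sup>Tx\<close>, and \<open>trace (QY) \<ge> \<lambda> trace Y\<close>. As
  \<open>\<lambda> < 0\<close>, this bounds \<open>trace (QX)\<close> from below by \<open>x\<^sup>TQx + \<lambda>(1 - x\<^sup>Tx)\<close>
  (\<open>sdp_objective_lower_bound\<close>). Now move \<open>x\<close> to a point \<open>x + tz\<close> of the unit sphere. The linear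
  constraints keep their values, and the quadratic part becomes \<open>x\<^sup>TQx + \<lambda>(2t x\<^sup>Tz + t\<^sup>2 z\<^sup>Tz)\<close>,
  which is the same lower bound because the bracket is what \<open>x\<^sup>Tx\<close> lacks to \<open>1\<close>. Since
  \<open>x\<close> is in the ball, the line meets the sphere for some \<open>t \<ge> 0\<close> and for some \<open>t \<le> 0\<close>, so \<open>t\<close> can
  be chosen with \<open>t c\<^sup>Tz \<le> 0\<close>
  (\<open>line_meets_sphere_descending\<close>). Hence some feasible point of the trust region problem does at
  least as well as \<open>(x, X)\<close> (\<open>tr_value_le_sdp_value\<close>). The converse inequality comes from
  \<open>X = xx\<^sup>T\<close>.

  Two classical facts carry the estimate of \<open>trace (QY)\<close>. The matrix \<open>Q - \<lambda>I\<close> is positive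
  semidefinite: the infimum of the Rayleigh quotient is an eigenvalue
  (\<open>symmetric_least_eigenvalue\<close>), by an argument with the Cauchy--Schwarz inequality in place of
  compactness. And the trace of a product of two positive semidefinite matrices is nonnegative
  (\<open>pos_semidef_trace_mult_nonneg\<close>), by splitting off rank-one pieces of one factor.

  For the implication from \<open>DC\<close>, a kernel of dimension greater than the rank of the \<open>a\<^sub>i\<close> contains
  a nonzero vector orthogonal to all \<open>a\<^sub>i\<close> (\<open>kernel_meets_orthogonal_complement\<close>).\<close>

section \<open>Orthogonality and dimension\<close>

lemma real_scalar_prod_self: "x \<in> carrier_vec n \<Longrightarrow> x \<bullet> x = (\<Sum>i<n. (x $ i)\<^sup>2)" for x :: "real vec"
  by (auto simp: scalar_prod_def power2_eq_square atLeast0LessThan)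

lemma real_scalar_prod_self_nonneg: "0 \<le> x \<bullet> x" for x :: "real vec"
  using real_scalar_prod_self[of x "dim_vec x"] by (simp add: sum_nonneg)

lemma real_scalar_prod_self_pos: "x \<in> carrier_vec n \<Longrightarrow> x \<noteq> 0\<^sub>v n \<Longrightarrow> 0 < x \<bullet> x" for x :: "real vec"
  using conjugate_square_eq_0_vec[of x n] real_scalar_prod_self_nonneg[of x] by auto

lemma (in vec_space) maximal_independent_subset:
  assumes S: "S \<subseteq> carrier_vec n" and finS: "finite S"
  obtains U where "U \<subseteq> S" "lin_indpt U" "card U = span_dim S" "S \<subseteq> span U"
proof -
  have "lin_indpt {}"
    by (simp add: lin_dep_def)
  then obtain U where U: "maximal U (\<lambda>T. T \<subseteq> S \<and> lin_indpt T)"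
    using maximal_exists_superset[OF finS, of "\<lambda>T. T \<subseteq> S \<and> lin_indpt T" "{}"] by auto
  then have US: "U \<subseteq> S" and li: "lin_indpt U"
    by (auto simp: maximal_def)
  have Uc: "U \<subseteq> carrier_vec n" using US S by (rule subset_trans)
  have "s \<in> span U" if s: "s \<in> S" for s
  proof (rule ccontr)
    assume ns: "s \<notin> span U"
    have "s \<notin> U"
      using ns span_mem[OF Uc] by metis
    moreover have sc: "s \<in> carrier_vec n" using s S by (rule subsetD[rotated])
    have "lin_indpt (U \<union> {s})"
      using lin_dep_iff_in_span[OF Uc li sc \<open>s \<notin> U\<close>] ns by metis
    moreover have "U \<union> {s} \<subseteq> S" using US s by simp
    ultimately show False
      using U unfolding maximal_def by (metis Un_upper1 Un_insert_right insertI1)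
  qed
  then have "S \<subseteq> span U" by (rule subsetI)
  moreover have "card U = span_dim S"
    unfolding span_dim_def by (rule dim_span[OF S finS U, symmetric])
  ultimately show ?thesis
    using that US li by metis
qed

text \<open>Fewer than \<open>n\<close> homogeneous linear equations in \<open>n\<close> unknowns have a nontrivial solution: a square
  coefficient matrix with a zero row is singular.\<close>

lemma nonzero_orthogonal_to_few_vectors:
  fixes S :: "'a :: field vec set"
  assumes S: "S \<subseteq> carrier_vec n" and finS: "finite S" and card: "card S < n"
  obtains z where "z \<in> carrier_vec n" "z \<noteq> 0\<^sub>v n" "\<And>v. v \<in> S \<Longrightarrow> v \<bullet> z = 0"
proof -
  obtain vs where vs: "set vs = S" "distinct vs"
    using finite_distinct_list[OF finS] by auto
  with card have len: "length vs < n"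
    using distinct_card by fastforce
  define A where "A = mat n n (\<lambda>(i, j). if i < length vs then vs ! i $ j else 0)"
  have A: "A \<in> carrier_mat n n"
    by (simp add: A_def)
  \<comment> \<open>Row \<open>n - 1\<close> of \<open>A\<close> is padding, hence zero, since \<open>length vs < n\<close>.\<close>
  have "A\<^sup>T *\<^sub>v unit_vec n (n - 1) = 0\<^sub>v n"
    using len by (intro eq_vecI) (auto simp: A_def)
  moreover have "unit_vec n (n - 1) \<noteq> (0\<^sub>v n :: 'a vec)"
    using len unit_vec_nonzero[of "n - 1" n] by auto
  ultimately have "det A\<^sup>T = 0"
    using det_0_iff_vec_prod_zero_field[of "A\<^sup>T" n] A unit_vec_carrier transpose_carrier_mat
    by blast
  then have "det A = 0"
    using det_transpose[OF A] by simp
  then obtain z where z: "z \<in> carrier_vec n" "z \<noteq> 0\<^sub>v n" "A *\<^sub>v z = 0\<^sub>v n"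
    using det_0_iff_vec_prod_zero_field[OF A] by blast
  have "v \<bullet> z = 0" if v: "v \<in> S" for v
  proof -
    obtain i where i: "i < length vs" "vs ! i = v"
      using v vs(1) by (auto simp: in_set_conv_nth)
    have "row A i = v"
      using i len S v by (intro eq_vecI) (auto simp: A_def)
    then show ?thesis
      using arg_cong[OF z(3), of "\<lambda>w. w $ i"] A i len by simp
  qed
  with z that show ?thesis by blast
qed

lemma (in vec_space) orthogonal_to_span:
  assumes U: "U \<subseteq> carrier_vec n" and z: "z \<in> carrier_vec n"
    and orth: "\<And>u. u \<in> U \<Longrightarrow> u \<bullet> z = 0"
    and v: "v \<in> span U"
  shows "v \<bullet> z = 0"
proof -
  have vc: "v \<in> carrier_vec n"
    using U v span_closed by auto
  have "z \<in> orthogonal_complement U"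
    using U z orth comm_scalar_prod[of z n] unfolding orthogonal_complement_def by auto
  then have "z \<bullet> v = 0"
    using in_orthogonal_complement_span[OF U] v
    unfolding orthogonal_complement_def by auto
  then show ?thesis
    using comm_scalar_prod[OF vc z] by simp
qed

text \<open>A proper subspace has a nonzero normal vector, found by solving the equations given by a basis.
  Conversely a normal vector \<open>z\<close> to a full span is orthogonal to itself; here the scalars must be
  real for \<open>z \<bullet> z = 0\<close> to force \<open>z = 0\<close>.\<close>

lemma span_dim_less_iff_orthogonal:
  fixes S :: "real vec set"
  assumes S: "S \<subseteq> carrier_vec n" and finS: "finite S"
  shows "vec_space.span_dim n S < n \<longleftrightarrow>
    (\<exists>z \<in> carrier_vec n. z \<noteq> 0\<^sub>v n \<and> (\<forall>v\<in>S. v \<bullet> z = 0))"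
proof -
  interpret vec_space "TYPE(real)" n .
  obtain U where U: "U \<subseteq> S" "lin_indpt U" "card U = span_dim S" "S \<subseteq> span U"
    using maximal_independent_subset[OF S finS] by blast
  have Uc: "U \<subseteq> carrier_vec n" and Uf: "finite U"
    using U(1) S finS finite_subset by blast+
  show ?thesis
  proof
    assume "span_dim S < n"
    then obtain z where z: "z \<in> carrier_vec n" "z \<noteq> 0\<^sub>v n" "\<And>v. v \<in> U \<Longrightarrow> v \<bullet> z = 0"
      using nonzero_orthogonal_to_few_vectors[OF Uc Uf] U(3) by metis
    then show "\<exists>z \<in> carrier_vec n. z \<noteq> 0\<^sub>v n \<and> (\<forall>v\<in>S. v \<bullet> z = 0)"
      using orthogonal_to_span[OF Uc] U(4) by blast
  next
    assume "\<exists>z \<in> carrier_vec n. z \<noteq> 0\<^sub>v n \<and> (\<forall>v\<in>S. v \<bullet> z = 0)"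
    then obtain z where z: "z \<in> carrier_vec n" "z \<noteq> 0\<^sub>v n" "\<forall>v\<in>S. v \<bullet> z = 0"
      by blast
    show "span_dim S < n"
    proof (rule ccontr)
      assume "\<not> span_dim S < n"
      then have "basis U"
        using U(2,3) Uc Uf dim_is_n by (intro dim_li_is_basis) auto
      then have "z \<in> span U"
        using z(1) unfolding basis_def by auto
      then have "z \<bullet> z = 0"
        using orthogonal_to_span[OF Uc z(1)] z(3) U(1) by blast
      then show False
        using real_scalar_prod_self_pos[OF z(1,2)] by simp
    qed
  qed
qed

text \<open>Parametrise the kernel by the coefficients \<open>w\<close> with respect to a basis, the columns of \<open>M\<close>.
  Orthogonality of \<open>M *\<^sub>v w\<close> to \<open>v\<close> is one linear equation \<open>(M\<^sup>T *\<^sub>v v) \<bullet> w = 0\<close> in \<open>w\<close>, and there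
  are fewer equations than coefficients.\<close>

lemma kernel_meets_orthogonal_complement:
  fixes A :: "'a :: field mat"
  assumes A: "A \<in> carrier_mat nr n" and S: "S \<subseteq> carrier_vec n" "finite S"
    and card: "card S < kernel_dim A"
  obtains z where "z \<in> carrier_vec n" "z \<noteq> 0\<^sub>v n" "A *\<^sub>v z = 0\<^sub>v nr"
    "\<And>v. v \<in> S \<Longrightarrow> v \<bullet> z = 0"
proof -
  interpret kernel nr n A by unfold_locales (rule A)
  obtain B where B: "finite B" "basis B"
    using kernel_basis_exists[OF A] by blast
  obtain bs where bs: "set bs = B" "distinct bs"
    using finite_distinct_list[OF B(1)] by blast
  define k where "k = length bs"
  have k: "kernel_dim A = k"
    using Ker.dim_basis[OF B] distinct_card[OF bs(2)] bs(1) by (simp add: k_def)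
  have Bker: "B \<subseteq> mat_kernel A"
    using B(2) unfolding Ker.basis_def by auto
  then have Bc: "set bs \<subseteq> carrier_vec n"
    using mat_kernel_carrier[OF A] bs(1) by blast
  define M where "M = mat_of_cols n bs"
  have M: "M \<in> carrier_mat n k" and cM: "cols M = bs"
    using Bc by (auto simp: M_def k_def)
  have "card ((\<lambda>v. M\<^sup>T *\<^sub>v v) ` S) < k"
    using card_image_le[OF S(2), of "\<lambda>v. M\<^sup>T *\<^sub>v v"] card k by linarith
  moreover have "(\<lambda>v. M\<^sup>T *\<^sub>v v) ` S \<subseteq> carrier_vec k"
    using M S(1) mult_mat_vec_carrier[of "M\<^sup>T" k n] by auto
  ultimately obtain w where w: "w \<in> carrier_vec k" "w \<noteq> 0\<^sub>v k"
    and orth: "\<And>u. u \<in> (\<lambda>v. M\<^sup>T *\<^sub>v v) ` S \<Longrightarrow> u \<bullet> w = 0"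
    using nonzero_orthogonal_to_few_vectors[of "(\<lambda>v. M\<^sup>T *\<^sub>v v) ` S" k] S(2) by blast
  have "NC.lin_indpt (set (cols M))"
    using B(2) lindep_same[OF Bker] unfolding Ker.basis_def cM bs(1) by auto
  then have "M *\<^sub>v w \<noteq> 0\<^sub>v n"
    using NC.lin_depI[OF M w] cM bs(2) by auto
  moreover have "v \<bullet> (M *\<^sub>v w) = 0" if "v \<in> S" for v
    using orth[of "M\<^sup>T *\<^sub>v v"] transpose_vec_mult_scalar[OF M w(1)] that S(1) by auto
  moreover have "A *\<^sub>v (M *\<^sub>v w) = 0\<^sub>v nr"
  proof -
    have "A * M = 0\<^sub>m nr k"
    proof (rule eq_matI)
      fix i j
      assume ij: "i < dim_row (0\<^sub>m nr k :: 'a mat)" "j < dim_col (0\<^sub>m nr k :: 'a mat)"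
      then have "bs ! j \<in> mat_kernel A"
        using Bker bs(1) k_def by auto
      moreover have "col M j = bs ! j"
        using ij M cM cols_nth[of j M] by simp
      ultimately have "A *\<^sub>v col M j = 0\<^sub>v nr"
        using mat_kernelD(2)[OF A] by simp
      moreover have "(A * M) $$ (i, j) = (A *\<^sub>v col M j) $ i"
        using ij A M by simp
      ultimately show "(A * M) $$ (i, j) = (0\<^sub>m nr k) $$ (i, j)"
        using ij by simp
    qed (use A M in auto)
    then show ?thesis
      using assoc_mult_mat_vec[OF A M w(1)] w(1) by (auto intro!: eq_vecI simp flip: assoc_mult_mat_vec[OF A M w(1)])
  qed
  ultimately show ?thesis
    using that[of "M *\<^sub>v w"] M w(1) by auto
qed

section \<open>Positive semidefinite forms and the least eigenvalue\<close>

lemma quad_form_bounded: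
  fixes A :: "real mat"
  assumes A: "A \<in> carrier_mat n n"
  obtains K where "K > 0" "\<And>x. x \<in> carrier_vec n \<Longrightarrow> \<bar>x \<bullet> (A *\<^sub>v x)\<bar> \<le> K * (x \<bullet> x)"
proof -
  \<comment> \<open>The summand \<open>1\<close> makes \<open>K\<close> positive even for \<open>A = 0\<close>.\<close>
  define K where "K = 1 + (\<Sum>i<n. \<Sum>j<n. \<bar>A $$ (i, j)\<bar>)"
  have "\<bar>x \<bullet> (A *\<^sub>v x)\<bar> \<le> K * (x \<bullet> x)" if x: "x \<in> carrier_vec n" for x
  proof -
    have entry: "\<bar>x $ i * x $ j\<bar> \<le> x \<bullet> x" if "i < n" "j < n" for i j
    proof -
      have sq: "(x $ k)\<^sup>2 \<le> x \<bullet> x" if "k < n" for k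
        using that member_le_sum[of k "{..<n}" "\<lambda>i. (x $ i)\<^sup>2"]
        by (simp add: real_scalar_prod_self[OF x])
      have "2 * \<bar>x $ i * x $ j\<bar> \<le> (x $ i)\<^sup>2 + (x $ j)\<^sup>2"
        using sum_squares_bound[of "\<bar>x $ i\<bar>" "\<bar>x $ j\<bar>"] by (simp add: abs_mult)
      then show ?thesis
        using sq[OF that(1)] sq[OF that(2)] by linarith
    qed
    have "x \<bullet> (A *\<^sub>v x) = (\<Sum>i<n. \<Sum>j<n. A $$ (i, j) * (x $ i * x $ j))"
      using A x by (auto simp: scalar_prod_def atLeast0LessThan sum_distrib_left mult_ac intro!: sum.cong)
    also have "\<bar>\<dots>\<bar> \<le> (\<Sum>i<n. \<Sum>j<n. \<bar>A $$ (i, j)\<bar> * \<bar>x $ i * x $ j\<bar>)"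
      by (rule order_trans[OF sum_abs] sum_mono)+ (simp add: abs_mult mult.assoc)
    also have "\<dots> \<le> (\<Sum>i<n. \<Sum>j<n. \<bar>A $$ (i, j)\<bar> * (x \<bullet> x))"
      by (intro sum_mono mult_left_mono entry) auto
    also have "\<dots> \<le> K * (x \<bullet> x)"
      using real_scalar_prod_self_nonneg[of x]
      by (simp add: K_def algebra_simps flip: sum_distrib_right sum_distrib_left)
    finally show ?thesis .
  qed
  moreover have "K > 0"
    unfolding K_def by (intro add_pos_nonneg sum_nonneg) auto
  ultimately show ?thesis
    using that by blast
qed

lemma symmetric_form_swap:
  fixes A :: "real mat"
  assumes "A \<in> carrier_mat n n" "A\<^sup>T = A" "x \<in> carrier_vec n" "y \<in> carrier_vec n"
  shows "y \<bullet> (A *\<^sub>v x) = x \<bullet> (A *\<^sub>v y)"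
proof -
  have "y \<bullet> (A *\<^sub>v x) = (A *\<^sub>v y) \<bullet> x"
    using transpose_vec_mult_scalar[OF assms(1,3,4)] assms(2) by simp
  then show ?thesis
    using assms comm_scalar_prod[of x n "A *\<^sub>v y"] by auto
qed

lemma quad_form_line:
  fixes A :: "real mat"
  assumes A: "A \<in> carrier_mat n n" "A\<^sup>T = A" and x: "x \<in> carrier_vec n" and y: "y \<in> carrier_vec n"
  shows "(x + t \<cdot>\<^sub>v y) \<bullet> (A *\<^sub>v (x + t \<cdot>\<^sub>v y)) =
    x \<bullet> (A *\<^sub>v x) + 2 * t * (x \<bullet> (A *\<^sub>v y)) + t\<^sup>2 * (y \<bullet> (A *\<^sub>v y))"
proof -
  have c: "A *\<^sub>v x \<in> carrier_vec n" "A *\<^sub>v y \<in> carrier_vec n"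
    using A x y by (auto intro: mult_mat_vec_carrier)
  have "A *\<^sub>v (x + t \<cdot>\<^sub>v y) = A *\<^sub>v x + t \<cdot>\<^sub>v (A *\<^sub>v y)"
    using A x y by (simp add: mult_add_distrib_mat_vec mult_mat_vec)
  then show ?thesis
    using A x y c symmetric_form_swap[OF A x y]
    by (simp add: add_scalar_prod_distrib[of _ n] scalar_prod_add_distrib[of _ n] power2_eq_square algebra_simps)
qed

lemma pos_semidef_nonneg:
  "pos_semidef A \<Longrightarrow> A \<in> carrier_mat n n \<Longrightarrow> x \<in> carrier_vec n \<Longrightarrow> 0 \<le> x \<bullet> (A *\<^sub>v x)"
  by (auto simp: pos_semidef_def)

lemma pos_semidef_symmetric: "pos_semidef A \<Longrightarrow> A\<^sup>T = A"
  by (auto simp: pos_semidef_def)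

lemma pos_semidefI:
  "A \<in> carrier_mat n n \<Longrightarrow> A\<^sup>T = A \<Longrightarrow> (\<And>x. x \<in> carrier_vec n \<Longrightarrow> 0 \<le> x \<bullet> (A *\<^sub>v x)) \<Longrightarrow> pos_semidef A"
  by (auto simp: pos_semidef_def)

text \<open>The polynomial \<open>t \<mapsto> (x + ty)\<^sup>TA(x + ty)\<close> is nonnegative, so its discriminant is at most \<open>0\<close>.\<close>

lemma pos_semidef_Cauchy_Schwarz:
  assumes A: "A \<in> carrier_mat n n" and psd: "pos_semidef A"
    and x: "x \<in> carrier_vec n" and y: "y \<in> carrier_vec n"
  shows "(x \<bullet> (A *\<^sub>v y))\<^sup>2 \<le> (x \<bullet> (A *\<^sub>v x)) * (y \<bullet> (A *\<^sub>v y))"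
proof -
  define p q r where "p = x \<bullet> (A *\<^sub>v x)" and "q = x \<bullet> (A *\<^sub>v y)" and "r = y \<bullet> (A *\<^sub>v y)"
  have nonneg: "0 \<le> p + 2 * t * q + t\<^sup>2 * r" for t
    using pos_semidef_nonneg[OF psd A, of "x + t \<cdot>\<^sub>v y"] x y
      quad_form_line[OF A pos_semidef_symmetric[OF psd] x y, of t]
    by (simp add: p_def q_def r_def)
  have "r \<ge> 0"
    unfolding r_def by (rule pos_semidef_nonneg[OF psd A y])
  \<comment> \<open>For \<open>r > 0\<close> take the minimiser \<open>t = - q / r\<close>. For \<open>r = 0\<close> the polynomial is affine, and with
    \<open>q \<noteq> 0\<close> it takes the value \<open>- 1\<close>.\<close>
  then consider "r > 0" | "r = 0" "q = 0" | "r = 0" "q \<noteq> 0"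
    by fastforce
  then have "q\<^sup>2 \<le> p * r"
  proof cases
    case 1
    then show ?thesis
      using nonneg[of "- q / r"] by (simp add: field_simps power2_eq_square)
  next
    case 3
    then show ?thesis
      using nonneg[of "- (p + 1) / (2 * q)"] by (simp add: field_simps)
  qed simp
  then show ?thesis
    by (simp add: p_def q_def r_def)
qed

text \<open>Cauchy--Schwarz for the pair \<open>x\<close> and \<open>A\<^sup>-\<^sup>1x\<close> gives
  \<open>(x\<^sup>Tx)\<^sup>2 \<le> (x\<^sup>TAx) (x\<^sup>TA\<^sup>-\<^sup>1x)\<close>, and the last factor is at most a multiple of \<open>x\<^sup>Tx\<close>.\<close>

lemma pos_semidef_invertible_coercive:
  assumes A: "A \<in> carrier_mat n n" and psd: "pos_semidef A" and det: "det A \<noteq> 0"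
  obtains e where "e > 0" "\<And>x. x \<in> carrier_vec n \<Longrightarrow> e * (x \<bullet> x) \<le> x \<bullet> (A *\<^sub>v x)"
proof -
  obtain B where B: "B \<in> carrier_mat n n" "A * B = 1\<^sub>m n"
    using det_non_zero_imp_unit[OF A det, of "()"] by (auto simp: Units_def ring_mat_def)
  obtain K where K: "K > 0" "\<And>x. x \<in> carrier_vec n \<Longrightarrow> \<bar>x \<bullet> (B *\<^sub>v x)\<bar> \<le> K * (x \<bullet> x)"
    using quad_form_bounded[OF B(1)] by blast
  have "1 / K * (x \<bullet> x) \<le> x \<bullet> (A *\<^sub>v x)" if x: "x \<in> carrier_vec n" for x
  proof (cases "x \<bullet> x = 0")
    case True
    then show ?thesis
      using pos_semidef_nonneg[OF psd A x] by simp
  next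
    case False
    then have pos: "x \<bullet> x > 0"
      using real_scalar_prod_self_nonneg[of x] by linarith
    define y where "y = B *\<^sub>v x"
    have y: "y \<in> carrier_vec n"
      using B x by (auto simp: y_def intro: mult_mat_vec_carrier)
    have Ay: "A *\<^sub>v y = x"
      using assoc_mult_mat_vec[OF A B(1) x] B(2) x by (simp add: y_def)
    have "(x \<bullet> x)\<^sup>2 \<le> (x \<bullet> (A *\<^sub>v x)) * (y \<bullet> x)"
      using pos_semidef_Cauchy_Schwarz[OF A psd x y] by (simp add: Ay)
    also have "y \<bullet> x = x \<bullet> (B *\<^sub>v x)"
      using comm_scalar_prod[OF x y] by (simp add: y_def)
    also have "(x \<bullet> (A *\<^sub>v x)) * (x \<bullet> (B *\<^sub>v x)) \<le> (x \<bullet> (A *\<^sub>v x)) * (K * (x \<bullet> x))"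
      using K(2)[OF x] pos_semidef_nonneg[OF psd A x] by (intro mult_left_mono) auto
    finally have "(x \<bullet> x) * (x \<bullet> x) \<le> (K * (x \<bullet> (A *\<^sub>v x))) * (x \<bullet> x)"
      by (simp add: power2_eq_square mult_ac)
    then have "x \<bullet> x \<le> K * (x \<bullet> (A *\<^sub>v x))"
      using pos by simp
    then show ?thesis
      using K(1) by (simp add: field_simps)
  qed
  then show ?thesis
    using that[of "1 / K"] K(1) by simp
qed

lemma shift_mult_vec:
  fixes Q :: "real mat"
  assumes "Q \<in> carrier_mat n n" "x \<in> carrier_vec n"
  shows "(Q - k \<cdot>\<^sub>m 1\<^sub>m n) *\<^sub>v x = Q *\<^sub>v x - k \<cdot>\<^sub>v x"
proof -
  have "(k \<cdot>\<^sub>m 1\<^sub>m n) *\<^sub>v x = k \<cdot>\<^sub>v x"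
    using assms(2) by (intro eq_vecI) auto
  then show ?thesis
    using assms by (simp add: minus_mult_distrib_mat_vec[of _ n n])
qed

lemma shift_quad_form:
  fixes Q :: "real mat"
  assumes "Q \<in> carrier_mat n n" "x \<in> carrier_vec n"
  shows "x \<bullet> ((Q - k \<cdot>\<^sub>m 1\<^sub>m n) *\<^sub>v x) = x \<bullet> (Q *\<^sub>v x) - k * (x \<bullet> x)"
  unfolding shift_mult_vec[OF assms]
  using assms by (subst scalar_prod_minus_distrib[of _ n]) (auto intro: mult_mat_vec_carrier)

lemma shift_symmetric:
  fixes Q :: "real mat"
  assumes Q: "Q \<in> carrier_mat n n" "Q\<^sup>T = Q"
  shows "(Q - k \<cdot>\<^sub>m 1\<^sub>m n)\<^sup>T = Q - k \<cdot>\<^sub>m 1\<^sub>m n"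
proof (rule eq_matI)
  fix i j assume "i < dim_row (Q - k \<cdot>\<^sub>m 1\<^sub>m n)" "j < dim_col (Q - k \<cdot>\<^sub>m 1\<^sub>m n)"
  then have "i < n" "j < n"
    by auto
  moreover from this have "Q $$ (j, i) = Q $$ (i, j)"
    using arg_cong[OF Q(2), of "\<lambda>A. A $$ (i, j)"] Q(1) by auto
  ultimately show "(Q - k \<cdot>\<^sub>m 1\<^sub>m n)\<^sup>T $$ (i, j) = (Q - k \<cdot>\<^sub>m 1\<^sub>m n) $$ (i, j)"
    using Q(1) by auto
qed auto

text \<open>Take for \<open>\<mu>\<close> the infimum of the form on the unit sphere. Then \<open>Q - \<mu>I\<close> is positive semidefinite. If
  it were invertible it would be coercive, which would leave room to increase \<open>\<mu>\<close>; so it is singular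
  and \<open>\<mu>\<close> is an eigenvalue.\<close>

lemma symmetric_least_eigenvalue:
  fixes Q :: "real mat"
  assumes n: "n \<ge> 1" and Q: "Q \<in> carrier_mat n n" "Q\<^sup>T = Q"
  obtains \<mu> where "eigenvalue Q \<mu>" "\<And>x. x \<in> carrier_vec n \<Longrightarrow> \<mu> * (x \<bullet> x) \<le> x \<bullet> (Q *\<^sub>v x)"
proof -
  define S where "S = (\<lambda>x. x \<bullet> (Q *\<^sub>v x)) ` {x \<in> carrier_vec n. x \<bullet> x = 1}"
  define \<mu> where "\<mu> = Inf S"
  define A where "A = Q - \<mu> \<cdot>\<^sub>m 1\<^sub>m n"
  have A: "A \<in> carrier_mat n n" and As: "A\<^sup>T = A"
    using Q shift_symmetric[OF Q] by (auto simp: A_def)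
  obtain K where K: "\<And>x. x \<in> carrier_vec n \<Longrightarrow> \<bar>x \<bullet> (Q *\<^sub>v x)\<bar> \<le> K * (x \<bullet> x)"
    using quad_form_bounded[OF Q(1)] by blast
  have "unit_vec n 0 \<bullet> unit_vec n 0 = (1 :: real)"
    using n by simp
  then have ne: "S \<noteq> {}"
    unfolding S_def by (metis (mono_tags, lifting) empty_iff image_is_empty mem_Collect_eq unit_vec_carrier)
  have "bdd_below S"
    unfolding S_def by (rule bdd_belowI[of _ "- K"]) (use K in fastforce)
  then have le: "\<mu> \<le> s" if "s \<in> S" for s
    unfolding \<mu>_def using that by (rule cInf_lower[rotated])
  have ray: "\<mu> * (x \<bullet> x) \<le> x \<bullet> (Q *\<^sub>v x)" if x: "x \<in> carrier_vec n" for x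
  proof (cases "x = 0\<^sub>v n")
    case True
    then show ?thesis
      using Q by (simp add: scalar_prod_def)
  next
    case False
    then have pos: "x \<bullet> x > 0"
      using real_scalar_prod_self_pos[OF x] by simp
    define y where "y = (1 / sqrt (x \<bullet> x)) \<cdot>\<^sub>v x"
    have y: "y \<in> carrier_vec n"
      using x by (simp add: y_def)
    have "y \<bullet> y = 1" "y \<bullet> (Q *\<^sub>v y) = (x \<bullet> (Q *\<^sub>v x)) / (x \<bullet> x)"
      using x Q pos mult_mat_vec_carrier[OF Q(1) x] by (auto simp: y_def mult_mat_vec field_simps)
    moreover from this have "y \<bullet> (Q *\<^sub>v y) \<in> S"
      using y unfolding S_def by blast
    ultimately have "\<mu> \<le> (x \<bullet> (Q *\<^sub>v x)) / (x \<bullet> x)"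
      using le by metis
    then show ?thesis
      using pos by (simp add: field_simps)
  qed
  have psd: "pos_semidef A"
    using ray shift_quad_form[OF Q(1)] by (intro pos_semidefI[OF A As]) (simp add: A_def)
  have "det A = 0"
  proof (rule ccontr)
    assume "det A \<noteq> 0"
    then obtain e where e: "e > 0" "\<And>x. x \<in> carrier_vec n \<Longrightarrow> e * (x \<bullet> x) \<le> x \<bullet> (A *\<^sub>v x)"
      using pos_semidef_invertible_coercive[OF A psd] by blast
    have "\<mu> + e \<le> s" if "s \<in> S" for s
      using that e(2) shift_quad_form[OF Q(1), of _ \<mu>] unfolding S_def A_def by force
    then have "\<mu> + e \<le> \<mu>"
      unfolding \<mu>_def using ne by (intro cInf_greatest) (auto simp: \<mu>_def)
    with e(1) show False by simp
  qed
  then obtain v where v: "v \<in> carrier_vec n" "v \<noteq> 0\<^sub>v n" "A *\<^sub>v v = 0\<^sub>v n"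
    using det_0_iff_vec_prod_zero_field[OF A] by blast
  then have "Q *\<^sub>v v - \<mu> \<cdot>\<^sub>v v = 0\<^sub>v n"
    using shift_mult_vec[OF Q(1) v(1)] by (simp add: A_def)
  then have "Q *\<^sub>v v = \<mu> \<cdot>\<^sub>v v"
    using Q v(1) by (auto simp: vec_eq_iff)
  then have "eigenvalue Q \<mu>"
    using v Q unfolding eigenvalue_def eigenvector_def by auto
  with ray that show ?thesis by blast
qed

lemma pos_semidef_shifted_mat:
  assumes n: "n \<ge> 1" and Q: "Q \<in> carrier_mat n n" "Q\<^sup>T = Q"
  shows "pos_semidef (shifted_mat n Q)"
proof -
  obtain \<mu> where \<mu>: "eigenvalue Q \<mu>" "\<And>x. x \<in> carrier_vec n \<Longrightarrow> \<mu> * (x \<bullet> x) \<le> x \<bullet> (Q *\<^sub>v x)"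
    using symmetric_least_eigenvalue[OF n Q] by blast
  \<comment> \<open>Finitely many eigenvalues, so that \<open>Min\<close> in the definition of \<open>lambda_min\<close> is a true minimum.\<close>
  have "char_poly Q \<noteq> 0"
    using degree_monic_char_poly[OF Q(1)] n by auto
  then have "finite {k. eigenvalue Q k}"
    using eigenvalue_root_char_poly[OF Q(1)] poly_roots_finite by simp
  then have "lambda_min Q \<le> \<mu>"
    using \<mu>(1) by (simp add: lambda_min_def)
  then have "lambda_min Q * (x \<bullet> x) \<le> x \<bullet> (Q *\<^sub>v x)" if "x \<in> carrier_vec n" for x
    using \<mu>(2)[OF that] real_scalar_prod_self_nonneg[of x] mult_right_mono by (metis order_trans)
  then show ?thesis
    using Q shift_quad_form[OF Q(1)] shift_symmetric[OF Q] unfolding shifted_mat_def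
    by (intro pos_semidefI[of _ n]) auto
qed

section \<open>Traces and rank-one matrices\<close>

definition outer :: "real vec \<Rightarrow> real mat" where
  "outer u = mat (dim_vec u) (dim_vec u) (\<lambda>(i, j). u $ i * u $ j)"

lemma outer_carrier [simp]: "u \<in> carrier_vec n \<Longrightarrow> outer u \<in> carrier_mat n n"
  by (simp add: outer_def)

lemma outer_transpose: "(outer u)\<^sup>T = outer u"
  by (auto simp: outer_def mult.commute)

lemma outer_mult_vec:
  assumes "u \<in> carrier_vec n" "y \<in> carrier_vec n"
  shows "outer u *\<^sub>v y = (u \<bullet> y) \<cdot>\<^sub>v u"
  using assms by (intro eq_vecI) (auto simp: outer_def scalar_prod_def sum_distrib_left sum_distrib_right mult_ac intro!: sum.cong)

lemma mat_trace_mult: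
  assumes "A \<in> carrier_mat n n" "B \<in> carrier_mat n n"
  shows "mat_trace (A * B) = (\<Sum>i<n. \<Sum>j<n. A $$ (i, j) * B $$ (j, i))"
  using assms by (auto simp: mat_trace_def scalar_prod_def atLeast0LessThan intro!: sum.cong)

lemma mat_trace_mult_outer:
  assumes "A \<in> carrier_mat n n" "u \<in> carrier_vec n"
  shows "mat_trace (A * outer u) = u \<bullet> (A *\<^sub>v u)"
  unfolding mat_trace_mult[OF assms(1) outer_carrier[OF assms(2)]]
  using assms by (auto simp: outer_def scalar_prod_def atLeast0LessThan sum_distrib_left mult_ac intro!: sum.cong)

lemma mat_trace_outer: "u \<in> carrier_vec n \<Longrightarrow> mat_trace (outer u) = u \<bullet> u"
  by (auto simp: mat_trace_def outer_def scalar_prod_def atLeast0LessThan)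

lemma mat_trace_minus_smult:
  assumes "A \<in> carrier_mat n n" "B \<in> carrier_mat n n"
  shows "mat_trace (A - k \<cdot>\<^sub>m B) = mat_trace A - k * mat_trace B"
  using assms by (simp add: mat_trace_def sum_subtractf sum_distrib_left)

lemma mat_trace_mult_minus_smult:
  assumes "A \<in> carrier_mat n n" "B \<in> carrier_mat n n" "C \<in> carrier_mat n n"
  shows "mat_trace (A * (B - k \<cdot>\<^sub>m C)) = mat_trace (A * B) - k * mat_trace (A * C)"
proof -
  have "A * (B - k \<cdot>\<^sub>m C) = A * B - k \<cdot>\<^sub>m (A * C)"
    using assms by (simp add: mult_minus_distrib_mat[of _ n n _ n] mult_smult_distrib[of _ n n _ n])
  then show ?thesis
    using assms by (simp add: mat_trace_minus_smult[of _ n])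
qed

lemma mat_trace_shift_mult:
  assumes "Q \<in> carrier_mat n n" "Y \<in> carrier_mat n n"
  shows "mat_trace ((Q - k \<cdot>\<^sub>m 1\<^sub>m n) * Y) = mat_trace (Q * Y) - k * mat_trace Y"
proof -
  have "(Q - k \<cdot>\<^sub>m 1\<^sub>m n) * Y = Q * Y - k \<cdot>\<^sub>m Y"
    using assms by (simp add: minus_mult_distrib_mat[of _ n n _ _ n] mult_smult_assoc_mat[of _ n n _ n])
  then show ?thesis
    using assms by (simp add: mat_trace_minus_smult[of _ n])
qed

lemma minus_smult_outer_form:
  assumes "Y \<in> carrier_mat n n" "u \<in> carrier_vec n" "y \<in> carrier_vec n"
  shows "y \<bullet> ((Y - k \<cdot>\<^sub>m outer u) *\<^sub>v y) = y \<bullet> (Y *\<^sub>v y) - k * (u \<bullet> y)\<^sup>2"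
proof -
  have "(k \<cdot>\<^sub>m outer u) *\<^sub>v y = k \<cdot>\<^sub>v (outer u *\<^sub>v y)"
    using assms by (intro eq_vecI) (auto simp: outer_def)
  then have "(Y - k \<cdot>\<^sub>m outer u) *\<^sub>v y = Y *\<^sub>v y - k \<cdot>\<^sub>v ((u \<bullet> y) \<cdot>\<^sub>v u)"
    using assms by (simp add: minus_mult_distrib_mat_vec[of _ n n] outer_mult_vec[of _ n])
  moreover have "Y *\<^sub>v y \<in> carrier_vec n"
    using assms by simp
  ultimately show ?thesis
    using assms comm_scalar_prod[OF assms(2,3)]
    by (simp add: scalar_prod_minus_distrib[of _ n] power2_eq_square)
qed

lemma minus_smult_outer_symmetric:
  assumes "Y \<in> carrier_mat n n" "Y\<^sup>T = Y" "u \<in> carrier_vec n"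
  shows "(Y - k \<cdot>\<^sub>m outer u)\<^sup>T = Y - k \<cdot>\<^sub>m outer u"
proof (rule eq_matI)
  fix i j assume "i < dim_row (Y - k \<cdot>\<^sub>m outer u)" "j < dim_col (Y - k \<cdot>\<^sub>m outer u)"
  then have "i < n" "j < n"
    using assms(3) by (auto simp: outer_def)
  moreover from this have "Y $$ (j, i) = Y $$ (i, j)"
    using arg_cong[OF assms(2), of "\<lambda>A. A $$ (i, j)"] assms(1) by auto
  ultimately show "(Y - k \<cdot>\<^sub>m outer u)\<^sup>T $$ (i, j) = (Y - k \<cdot>\<^sub>m outer u) $$ (i, j)"
    using assms(1,3) by (auto simp: outer_def)
qed (use assms(3) in \<open>auto simp: outer_def\<close>)

lemma unit_vec_form:
  fixes Y :: "real mat"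
  assumes "Y \<in> carrier_mat n n" "i < n"
  shows "unit_vec n i \<bullet> (Y *\<^sub>v unit_vec n i) = Y $$ (i, i)"
  using assms by simp

lemma pos_semidef_diag_nonneg:
  "pos_semidef Y \<Longrightarrow> Y \<in> carrier_mat n n \<Longrightarrow> i < n \<Longrightarrow> 0 \<le> Y $$ (i, i)"
  using pos_semidef_nonneg[of Y n "unit_vec n i"] unit_vec_form[of Y n i] by simp

lemma pos_semidef_trace_nonneg: "pos_semidef Y \<Longrightarrow> Y \<in> carrier_mat n n \<Longrightarrow> 0 \<le> mat_trace Y"
  unfolding mat_trace_def by (intro sum_nonneg pos_semidef_diag_nonneg[of _ n]) auto

text \<open>One step of symmetric Gaussian elimination. By Cauchy--Schwarz with a unit vector,
  \<open>(y\<^sup>TYe\<^sub>i)\<^sup>2 \<le> (y\<^sup>TYy) Y\<^sub>i\<^sub>i\<close>, so the subtracted square never exceeds \<open>y\<^sup>TYy\<close>.\<close>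

lemma pos_semidef_pivot:
  assumes Y: "Y \<in> carrier_mat n n" and psd: "pos_semidef Y" and i: "i < n" and d: "Y $$ (i, i) > 0"
  shows "pos_semidef (Y - (1 / Y $$ (i, i)) \<cdot>\<^sub>m outer (col Y i))"
proof (rule pos_semidefI)
  have u: "col Y i \<in> carrier_vec n"
    using Y by auto
  show "Y - (1 / Y $$ (i, i)) \<cdot>\<^sub>m outer (col Y i) \<in> carrier_mat n n"
    using Y u by (simp add: minus_carrier_mat)
  show "(Y - (1 / Y $$ (i, i)) \<cdot>\<^sub>m outer (col Y i))\<^sup>T = Y - (1 / Y $$ (i, i)) \<cdot>\<^sub>m outer (col Y i)"
    by (rule minus_smult_outer_symmetric[OF Y pos_semidef_symmetric[OF psd] u])
  fix y :: "real vec" assume y: "y \<in> carrier_vec n"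
  have "Y *\<^sub>v unit_vec n i = col Y i"
    using Y i by (intro eq_vecI) auto
  then have "(y \<bullet> col Y i)\<^sup>2 \<le> (y \<bullet> (Y *\<^sub>v y)) * Y $$ (i, i)"
    using pos_semidef_Cauchy_Schwarz[OF Y psd y, of "unit_vec n i"] unit_vec_form[OF Y i] by simp
  then show "0 \<le> y \<bullet> ((Y - (1 / Y $$ (i, i)) \<cdot>\<^sub>m outer (col Y i)) *\<^sub>v y)"
    using d comm_scalar_prod[OF u y] by (simp add: minus_smult_outer_form[OF Y u y] field_simps)
qed

text \<open>By Cauchy--Schwarz on unit vectors, \<open>Y\<^sub>i\<^sub>j\<^sup>2 \<le> Y\<^sub>i\<^sub>i Y\<^sub>j\<^sub>j\<close>.\<close>

lemma pos_semidef_zero_diag: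
  assumes Y: "Y \<in> carrier_mat n n" and psd: "pos_semidef Y" and z: "\<And>i. i < n \<Longrightarrow> Y $$ (i, i) = 0"
  shows "Y = 0\<^sub>m n n"
proof (rule eq_matI)
  fix i j assume "i < dim_row (0\<^sub>m n n :: real mat)" "j < dim_col (0\<^sub>m n n :: real mat)"
  then have ij: "i < n" "j < n"
    by auto
  then have "(unit_vec n i \<bullet> (Y *\<^sub>v unit_vec n j))\<^sup>2 \<le> 0"
    using pos_semidef_Cauchy_Schwarz[OF Y psd, of "unit_vec n i" "unit_vec n j"]
      unit_vec_form[OF Y] z by (metis mult_zero_left unit_vec_carrier)
  then show "Y $$ (i, j) = 0\<^sub>m n n $$ (i, j)"
    using Y ij by simp
qed (use Y in auto)

text \<open>Each elimination step removes from \<open>Y\<close> a positive multiple of some \<open>uu\<^sup>T\<close>, whose contribution to the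
  trace is a positive multiple of \<open>u\<^sup>TMu \<ge> 0\<close>. The step makes the pivot entry of the diagonal vanish and
  keeps the zeros already there, so the process ends with the zero matrix.\<close>

lemma pos_semidef_trace_mult_nonneg:
  assumes M: "M \<in> carrier_mat n n" "pos_semidef M"
    and Y: "Y \<in> carrier_mat n n" "pos_semidef Y"
  shows "0 \<le> mat_trace (M * Y)"
  using Y
proof (induction "card {i. i < n \<and> Y $$ (i, i) \<noteq> 0}" arbitrary: Y rule: less_induct)
  case less
  show ?case
  proof (cases "\<forall>i<n. Y $$ (i, i) = 0")
    case True
    then have "Y = 0\<^sub>m n n"
      using pos_semidef_zero_diag less.prems by blast
    then show ?thesis
      using M by (simp add: mat_trace_def)
  next
    case False
    then obtain i where i: "i < n" "Y $$ (i, i) \<noteq> 0"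
      by blast
    then have d: "Y $$ (i, i) > 0"
      using pos_semidef_diag_nonneg[OF less.prems(2,1) i(1)] by simp
    define u where "u = col Y i"
    define Y' where "Y' = Y - (1 / Y $$ (i, i)) \<cdot>\<^sub>m outer u"
    have u: "u \<in> carrier_vec n"
      using less.prems by (auto simp: u_def)
    have Y': "Y' \<in> carrier_mat n n"
      using less.prems u by (simp add: Y'_def minus_carrier_mat)
    have psd: "pos_semidef Y'"
      unfolding Y'_def u_def by (rule pos_semidef_pivot[OF less.prems i(1) d])
    have diag: "Y' $$ (k, k) = Y $$ (k, k) - (Y $$ (k, i))\<^sup>2 / Y $$ (i, i)" if "k < n" for k
      using that less.prems u i(1) by (auto simp: Y'_def u_def outer_def power2_eq_square)
    \<comment> \<open>The new entry is at most the old one, \<open>0\<close>, and nonnegative because \<open>Y'\<close> is positive semidefinite.\<close>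
    have "Y' $$ (k, k) = 0" if "k < n" "Y $$ (k, k) = 0" for k
    proof -
      have "(Y $$ (k, i))\<^sup>2 / Y $$ (i, i) \<ge> 0"
        using d by simp
      then show ?thesis
        using pos_semidef_diag_nonneg[OF psd Y' that(1)] diag[OF that(1)] that(2) by linarith
    qed
    moreover have "Y' $$ (i, i) = 0"
      using diag[OF i(1)] d by (simp add: power2_eq_square)
    ultimately have "{k. k < n \<and> Y' $$ (k, k) \<noteq> 0} \<subset> {k. k < n \<and> Y $$ (k, k) \<noteq> 0}"
      using i by blast
    then have "card {k. k < n \<and> Y' $$ (k, k) \<noteq> 0} < card {k. k < n \<and> Y $$ (k, k) \<noteq> 0}"
      by (intro psubset_card_mono) auto
    then have "0 \<le> mat_trace (M * Y')"
      using less.hyps Y' psd by blast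
    moreover have "mat_trace (M * Y') = mat_trace (M * Y) - (1 / Y $$ (i, i)) * (u \<bullet> (M *\<^sub>v u))"
      unfolding Y'_def using mat_trace_mult_minus_smult[OF M(1) less.prems(1) outer_carrier[OF u]]
        mat_trace_mult_outer[OF M(1) u] by simp
    moreover have "(1 / Y $$ (i, i)) * (u \<bullet> (M *\<^sub>v u)) \<ge> 0"
      using d pos_semidef_nonneg[OF M(2,1) u] by simp
    ultimately show ?thesis
      by linarith
  qed
qed

section \<open>The two optimal values\<close>

lemma bordered_mat_form:
  fixes s :: real
  assumes X: "X \<in> carrier_mat n n" and x: "x \<in> carrier_vec n" and y: "y \<in> carrier_vec n"
  defines "w \<equiv> y @\<^sub>v vec 1 (\<lambda>_. s)"
  shows "w \<bullet> (bordered_mat n X x *\<^sub>v w) = y \<bullet> (X *\<^sub>v y) + 2 * s * (x \<bullet> y) + s\<^sup>2"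
proof -
  define e where "e = vec 1 (\<lambda>_. s)"
  have e: "e \<in> carrier_vec 1"
    by (simp add: e_def)
  have 1: "mat_of_cols n [x] *\<^sub>v e = s \<cdot>\<^sub>v x"
    using x by (intro eq_vecI) (auto simp: e_def scalar_prod_def mat_of_cols_def)
  have 2: "mat_of_rows n [x] *\<^sub>v y = vec 1 (\<lambda>_. x \<bullet> y)"
    using x y by (intro eq_vecI) (auto simp: mat_of_rows_def scalar_prod_def intro!: sum.cong)
  have Xy: "X *\<^sub>v y \<in> carrier_vec n"
    using X y by simp
  have blocks: "mat_of_cols n [x] \<in> carrier_mat n 1" "mat_of_rows n [x] \<in> carrier_mat 1 n"
    by (auto simp: mat_of_cols_def mat_of_rows_def)
  have "bordered_mat n X x *\<^sub>v w = (X *\<^sub>v y + s \<cdot>\<^sub>v x) @\<^sub>v (vec 1 (\<lambda>_. x \<bullet> y) + e)"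
    unfolding bordered_mat_def w_def e_def[symmetric]
    using four_block_mat_mult_vec[OF X blocks one_carrier_mat y e] 1 2 e by simp
  then have "w \<bullet> (bordered_mat n X x *\<^sub>v w) = y \<bullet> (X *\<^sub>v y + s \<cdot>\<^sub>v x) + e \<bullet> (vec 1 (\<lambda>_. x \<bullet> y) + e)"
    unfolding w_def e_def[symmetric] using X x y e Xy
    by (simp add: scalar_prod_append[of _ n _ 1])
  also have "y \<bullet> (X *\<^sub>v y + s \<cdot>\<^sub>v x) = y \<bullet> (X *\<^sub>v y) + s * (x \<bullet> y)"
    using x y Xy comm_scalar_prod[OF x y] by (simp add: scalar_prod_add_distrib[of _ n])
  also have "e \<bullet> (vec 1 (\<lambda>_. x \<bullet> y) + e) = s * (x \<bullet> y) + s\<^sup>2"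
    by (simp add: e_def scalar_prod_def power2_eq_square algebra_simps)
  finally show ?thesis
    by (simp add: algebra_simps)
qed

lemma bordered_mat_carrier:
  "X \<in> carrier_mat n n \<Longrightarrow> bordered_mat n X x \<in> carrier_mat (n + 1) (n + 1)"
  unfolding bordered_mat_def by (rule four_block_carrier_mat) auto

text \<open>Restrict the bordered form to the vectors \<open>(y, - x\<^sup>Ty)\<close>; this last coordinate minimises it for
  given \<open>y\<close>. The scalar \<open>1\<close> puts the matrix in the shape of the elimination lemmas.\<close>

lemma pos_semidef_Schur_complement:
  assumes X: "X \<in> carrier_mat n n" "X\<^sup>T = X" and x: "x \<in> carrier_vec n"
    and psd: "pos_semidef (bordered_mat n X x)"
  shows "pos_semidef (X - 1 \<cdot>\<^sub>m outer x)"
proof (rule pos_semidefI)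
  show "X - 1 \<cdot>\<^sub>m outer x \<in> carrier_mat n n"
    using X x by (simp add: minus_carrier_mat)
  show "(X - 1 \<cdot>\<^sub>m outer x)\<^sup>T = X - 1 \<cdot>\<^sub>m outer x"
    by (rule minus_smult_outer_symmetric[OF X x])
  fix y :: "real vec" assume y: "y \<in> carrier_vec n"
  show "0 \<le> y \<bullet> ((X - 1 \<cdot>\<^sub>m outer x) *\<^sub>v y)"
    using pos_semidef_nonneg[OF psd bordered_mat_carrier[OF X(1)], of "y @\<^sub>v vec 1 (\<lambda>_. - (x \<bullet> y))"]
      append_carrier_vec[OF y vec_carrier[of 1]]
    unfolding bordered_mat_form[OF X(1) x y] minus_smult_outer_form[OF X(1) x y]
    by (simp add: power2_eq_square)
qed

text \<open>At \<open>(y, s)\<close> the form of the bordered matrix is the square \<open>(x\<^sup>Ty + s)\<^sup>2\<close>.\<close>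

lemma pos_semidef_bordered_outer:
  assumes x: "x \<in> carrier_vec n"
  shows "pos_semidef (bordered_mat n (outer x) x)"
proof (rule pos_semidefI)
  have X: "outer x \<in> carrier_mat n n"
    using x by simp
  show "bordered_mat n (outer x) x \<in> carrier_mat (n + 1) (n + 1)"
    by (rule bordered_mat_carrier[OF X])
  show "(bordered_mat n (outer x) x)\<^sup>T = bordered_mat n (outer x) x"
    unfolding bordered_mat_def
    by (subst transpose_four_block_mat[OF X]) (auto simp: outer_transpose transpose_mat_of_cols transpose_mat_of_rows)
  fix w :: "real vec" assume w: "w \<in> carrier_vec (n + 1)"
  define y where "y = vec_first w n"
  have y: "y \<in> carrier_vec n"
    by (simp add: y_def)
  have "w = y @\<^sub>v vec 1 (\<lambda>_. w $ n)"
    using w by (intro eq_vecI) (auto simp: y_def vec_first_def less_Suc_eq)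
  moreover have "y \<bullet> (outer x *\<^sub>v y) = (x \<bullet> y)\<^sup>2"
    using x y comm_scalar_prod[OF x y] by (simp add: outer_mult_vec[OF x y] power2_eq_square)
  ultimately have "w \<bullet> (bordered_mat n (outer x) x *\<^sub>v w) = (x \<bullet> y + w $ n)\<^sup>2"
    using bordered_mat_form[OF X x y, of "w $ n"] by (simp add: power2_eq_square algebra_simps)
  then show "0 \<le> w \<bullet> (bordered_mat n (outer x) x *\<^sub>v w)"
    by simp
qed

lemma sdp_value_le_tr_value:
  assumes Q: "Q \<in> carrier_mat n n"
  shows "sdp_value n m Q c a b \<le> tr_value n m Q c a b"
  unfolding tr_value_def
proof (rule INF_greatest)
  fix x assume "x \<in> tr_feasible n m a b"
  then have x: "x \<in> carrier_vec n" "x \<bullet> x \<le> 1" "\<forall>i\<in>{1..m}. a i \<bullet> x \<le> b i"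
    by (auto simp: tr_feasible_def)
  then have "(x, outer x) \<in> sdp_feasible n m a b"
    using pos_semidef_bordered_outer[OF x(1)] mat_trace_outer[OF x(1)]
    by (auto simp: sdp_feasible_def outer_transpose)
  then have "sdp_value n m Q c a b \<le> ereal (1 / 2 * mat_trace (Q * outer x) + c \<bullet> x)"
    unfolding sdp_value_def by (rule INF_lower2) simp
  then show "sdp_value n m Q c a b \<le> ereal (1 / 2 * (x \<bullet> (Q *\<^sub>v x)) + c \<bullet> x)"
    using mat_trace_mult_outer[OF Q x(1)] by simp
qed

text \<open>The parameter solves \<open>(z\<^sup>Tz)t\<^sup>2 + 2(x\<^sup>Tz)t = 1 - x\<^sup>Tx\<close>. As \<open>x\<close> is in the ball, the right side is
  nonnegative, so one root is \<open>\<ge> 0\<close> and the other \<open>\<le> 0\<close>; the sign of \<open>g\<close> decides which to take.\<close>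

lemma line_meets_sphere_descending:
  fixes x z :: "real vec" and g :: real
  assumes x: "x \<in> carrier_vec n" "x \<bullet> x \<le> 1" and z: "z \<in> carrier_vec n" "z \<noteq> 0\<^sub>v n"
  obtains t where "(x + t \<cdot>\<^sub>v z) \<bullet> (x + t \<cdot>\<^sub>v z) = 1" "t * g \<le> 0"
    "2 * t * (x \<bullet> z) + t\<^sup>2 * (z \<bullet> z) = 1 - x \<bullet> x"
proof -
  define p q r where "p = z \<bullet> z" and "q = x \<bullet> z" and "r = 1 - x \<bullet> x"
  define s where "s = sqrt (q\<^sup>2 + p * r)"
  have p: "p > 0" and r: "r \<ge> 0"
    using real_scalar_prod_self_pos[OF z] x by (auto simp: p_def r_def)
  have "s \<ge> \<bar>q\<bar>"
    unfolding s_def using p r by (intro real_le_rsqrt) simp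
  then have sign: "(- q + s) / p \<ge> 0" "(- q - s) / p \<le> 0"
    using p by (auto simp: divide_le_0_iff)
  have s2: "s\<^sup>2 = q\<^sup>2 + p * r"
    unfolding s_def using p r by simp
  have root: "2 * t * q + t\<^sup>2 * p = r" if "t = (- q + s) / p \<or> t = (- q - s) / p" for t
  proof -
    have "(p * t + q)\<^sup>2 = s\<^sup>2"
      using that p by (auto simp: power2_eq_square)
    then have "p * (2 * t * q + t\<^sup>2 * p) = p * r"
      unfolding s2 by (simp add: power2_eq_square algebra_simps)
    then show ?thesis
      using p by simp
  qed
  obtain t where t: "t = (- q + s) / p \<or> t = (- q - s) / p" "t * g \<le> 0"
    using sign by (metis linear mult_nonneg_nonpos mult_nonpos_nonneg)
  have "(x + t \<cdot>\<^sub>v z) \<bullet> (x + t \<cdot>\<^sub>v z) = x \<bullet> x + (2 * t * q + t\<^sup>2 * p)"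
    using quad_form_line[OF one_carrier_mat _ x(1) z(1), of t] x z by (simp add: p_def q_def)
  then show ?thesis
    using that t(2) root[OF t(1)] by (simp add: p_def q_def r_def)
qed

text \<open>For \<open>Y = X - xx\<^sup>T\<close> both \<open>trace Y \<ge> 0\<close> and \<open>trace ((Q - \<lambda>I)Y) \<ge> 0\<close> hold. The first gives
  \<open>x\<^sup>Tx \<le> trace X \<le> 1\<close>. In the second, \<open>\<lambda> < 0\<close> allows \<open>trace X\<close> to be replaced by its upper bound \<open>1\<close>.\<close>

lemma sdp_objective_lower_bound:
  assumes n: "n \<ge> 1" and Q: "Q \<in> carrier_mat n n" "Q\<^sup>T = Q" and neg: "lambda_min Q < 0"
    and X: "X \<in> carrier_mat n n" "X\<^sup>T = X" "mat_trace X \<le> 1" and x: "x \<in> carrier_vec n"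
    and psd: "pos_semidef (bordered_mat n X x)"
  shows "x \<bullet> (Q *\<^sub>v x) + lambda_min Q * (1 - x \<bullet> x) \<le> mat_trace (Q * X)"
    and "x \<bullet> x \<le> 1"
proof -
  define k where "k = lambda_min Q"
  define Y where "Y = X - 1 \<cdot>\<^sub>m outer x"
  have Y: "Y \<in> carrier_mat n n"
    using X x by (simp add: Y_def minus_carrier_mat)
  have psdY: "pos_semidef Y"
    unfolding Y_def by (rule pos_semidef_Schur_complement[OF X(1,2) x psd])
  have tr: "mat_trace Y = mat_trace X - x \<bullet> x"
    using mat_trace_minus_smult[OF X(1) outer_carrier[OF x], of 1] mat_trace_outer[OF x]
    by (simp add: Y_def)
  then show "x \<bullet> x \<le> 1"
    using pos_semidef_trace_nonneg[OF psdY Y] X(3) by linarith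
  have "0 \<le> mat_trace (shifted_mat n Q * Y)"
    using pos_semidef_trace_mult_nonneg[OF _ pos_semidef_shifted_mat[OF n Q] Y psdY] Q
    by (simp add: shifted_mat_def minus_carrier_mat)
  also have "\<dots> = mat_trace (Q * Y) - k * mat_trace Y"
    unfolding shifted_mat_def k_def by (rule mat_trace_shift_mult[OF Q(1) Y])
  also have "mat_trace (Q * Y) = mat_trace (Q * X) - x \<bullet> (Q *\<^sub>v x)"
    unfolding Y_def using mat_trace_mult_minus_smult[OF Q(1) X(1) outer_carrier[OF x], of 1]
      mat_trace_mult_outer[OF Q(1) x] by simp
  finally have "x \<bullet> (Q *\<^sub>v x) + k * (mat_trace X - x \<bullet> x) \<le> mat_trace (Q * X)"
    unfolding tr by simp
  moreover have "k * (1 - x \<bullet> x) \<le> k * (mat_trace X - x \<bullet> x)"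
    using neg X(3) by (intro mult_left_mono_neg) (auto simp: k_def)
  ultimately show "x \<bullet> (Q *\<^sub>v x) + lambda_min Q * (1 - x \<bullet> x) \<le> mat_trace (Q * X)"
    unfolding k_def by linarith
qed

text \<open>Each feasible pair \<open>(x, X)\<close> is matched by the point \<open>y = x + tz\<close> on the unit sphere: the quadratic
  part of its objective equals the lower bound for \<open>trace (QX)\<close>, and \<open>t c\<^sup>Tz \<le> 0\<close> takes care of
  the linear part.\<close>

lemma tr_value_le_sdp_value:
  assumes n: "n \<ge> 1" and Q: "Q \<in> carrier_mat n n" "Q\<^sup>T = Q" and neg: "lambda_min Q < 0"
    and c: "c \<in> carrier_vec n" and a: "\<forall>i\<in>{1..m}. a i \<in> carrier_vec n"
    and z: "z \<in> carrier_vec n" "z \<noteq> 0\<^sub>v n" "shifted_mat n Q *\<^sub>v z = 0\<^sub>v n"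
      "\<forall>i\<in>{1..m}. a i \<bullet> z = 0"
  shows "tr_value n m Q c a b \<le> sdp_value n m Q c a b"
  unfolding sdp_value_def
proof (rule INF_greatest, clarify)
  fix x X assume "(x, X) \<in> sdp_feasible n m a b"
  then have x: "x \<in> carrier_vec n" "\<forall>i\<in>{1..m}. a i \<bullet> x \<le> b i"
    and X: "X \<in> carrier_mat n n" "X\<^sup>T = X" "mat_trace X \<le> 1"
    and psd: "pos_semidef (bordered_mat n X x)"
    by (auto simp: sdp_feasible_def)
  note bound = sdp_objective_lower_bound[OF n Q neg X x(1) psd]
  define k where "k = lambda_min Q"
  obtain t where t: "(x + t \<cdot>\<^sub>v z) \<bullet> (x + t \<cdot>\<^sub>v z) = 1" "t * (c \<bullet> z) \<le> 0"
    "2 * t * (x \<bullet> z) + t\<^sup>2 * (z \<bullet> z) = 1 - x \<bullet> x"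
    using line_meets_sphere_descending[OF x(1) bound(2) z(1,2)] by blast
  define y where "y = x + t \<cdot>\<^sub>v z"
  have y: "y \<in> carrier_vec n"
    using x z by (simp add: y_def)
  have "a i \<bullet> y = a i \<bullet> x" if "i \<in> {1..m}" for i
    using that a x z by (simp add: y_def scalar_prod_add_distrib[of _ n])
  then have feas: "y \<in> tr_feasible n m a b"
    using y t(1) x(2) by (simp add: tr_feasible_def flip: y_def)
  have "Q *\<^sub>v z - k \<cdot>\<^sub>v z = 0\<^sub>v n"
    using z(3) shift_mult_vec[OF Q(1) z(1)] by (simp add: shifted_mat_def k_def)
  then have Qz: "Q *\<^sub>v z = k \<cdot>\<^sub>v z"
    using Q z(1) by (auto simp: vec_eq_iff)
  have "y \<bullet> (Q *\<^sub>v y) = x \<bullet> (Q *\<^sub>v x) + k * (2 * t * (x \<bullet> z) + t\<^sup>2 * (z \<bullet> z))"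
    unfolding y_def quad_form_line[OF Q x(1) z(1)] Qz using x z by (simp add: algebra_simps)
  then have "y \<bullet> (Q *\<^sub>v y) \<le> mat_trace (Q * X)"
    using bound(1) unfolding t(3) k_def by simp
  moreover have "c \<bullet> y = c \<bullet> x + t * (c \<bullet> z)"
    using c x z by (simp add: y_def scalar_prod_add_distrib[of _ n])
  ultimately have "1 / 2 * (y \<bullet> (Q *\<^sub>v y)) + c \<bullet> y \<le> 1 / 2 * mat_trace (Q * X) + c \<bullet> x"
    using t(2) by linarith
  then show "tr_value n m Q c a b \<le> ereal (1 / 2 * mat_trace (Q * X) + c \<bullet> x)"
    unfolding tr_value_def by (intro INF_lower2[OF feas]) simp
qed

section \<open>The dimension conditions\<close>

lemma shifted_mat_carrier [simp]: "Q \<in> carrier_mat n n \<Longrightarrow> shifted_mat n Q \<in> carrier_mat n n"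
  by (simp add: shifted_mat_def minus_carrier_mat)

text \<open>Rank below \<open>n\<close> means that some nonzero \<open>z\<close> is orthogonal to all columns. The matrix \<open>Q - \<lambda>I\<close> is
  symmetric, so orthogonality to its columns is orthogonality to its rows, that is, membership in its
  kernel.\<close>

lemma NewDC_iff_common_null_vector:
  assumes n: "n \<ge> 1" and Q: "Q \<in> carrier_mat n n" "Q\<^sup>T = Q"
    and a: "\<forall>i\<in>{1..m}. a i \<in> carrier_vec n"
  shows "NewDC n m Q a \<longleftrightarrow>
    (\<exists>z \<in> carrier_vec n. z \<noteq> 0\<^sub>v n \<and> shifted_mat n Q *\<^sub>v z = 0\<^sub>v n \<and> (\<forall>i\<in>{1..m}. a i \<bullet> z = 0))"
proof -
  define M where "M = shifted_mat n Q"
  define vs where "vs = cols M @ map a [1..<Suc m]"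
  have M: "M \<in> carrier_mat n n"
    using Q by (simp add: M_def)
  have vs: "set vs \<subseteq> carrier_vec n"
    using a M cols_dim[of M] by (auto simp: vs_def)
  have rows: "rows M = cols M"
    using rows_transpose[of M] shift_symmetric[OF Q] by (simp add: M_def shifted_mat_def)
  have "(\<forall>v \<in> set (cols M). v \<bullet> z = 0) \<longleftrightarrow> M *\<^sub>v z = 0\<^sub>v n" for z
    unfolding rows[symmetric] using M by (auto simp: rows_def vec_eq_iff)
  moreover have "set (map a [1..<Suc m]) = a ` {1..m}"
    by (simp add: atLeastLessThanSuc_atLeastAtMost del: upt_Suc)
  ultimately have "(\<forall>v \<in> set vs. v \<bullet> z = 0) \<longleftrightarrow> M *\<^sub>v z = 0\<^sub>v n \<and> (\<forall>i\<in>{1..m}. a i \<bullet> z = 0)" for z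
    unfolding vs_def set_append by (simp add: ball_Un del: upt_Suc set_map set_upt)
  moreover have "NewDC n m Q a \<longleftrightarrow> vec_space.span_dim n (set vs) < n"
    using n cols_mat_of_cols[OF vs]
    by (auto simp: NewDC_def vec_space.rank_def vec_space.span_dim_def vs_def M_def)
  ultimately show ?thesis
    using span_dim_less_iff_orthogonal[OF vs List.finite_set] by (simp add: M_def)
qed

lemma DC_imp_NewDC:
  assumes n: "n \<ge> 1" and Q: "Q \<in> carrier_mat n n" "Q\<^sup>T = Q"
    and a: "\<forall>i\<in>{1..m}. a i \<in> carrier_vec n"
    and DC: "DC n m Q a"
  shows "NewDC n m Q a"
proof -
  interpret vec_space "TYPE(real)" n .
  have M: "shifted_mat n Q \<in> carrier_mat n n"
    using Q by simp
  have ac: "a ` {1..m} \<subseteq> carrier_vec n"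
    using a by blast
  obtain U where U: "U \<subseteq> a ` {1..m}" "card U = span_dim (a ` {1..m})" "a ` {1..m} \<subseteq> span U"
    by (rule maximal_independent_subset[OF ac finite_imageI[OF finite_atLeastAtMost]])
  have Uc: "U \<subseteq> carrier_vec n" "finite U"
    using U(1) ac finite_subset by blast+
  \<comment> \<open>It is enough to be orthogonal to a basis \<open>U\<close> of the span of the \<open>a\<^sub>i\<close>.\<close>
  have "card U < kernel_dim (shifted_mat n Q)"
    using DC U(2) by (simp add: DC_def)
  then obtain z where z: "z \<in> carrier_vec n" "z \<noteq> 0\<^sub>v n" "shifted_mat n Q *\<^sub>v z = 0\<^sub>v n"
    "\<And>v. v \<in> U \<Longrightarrow> v \<bullet> z = 0"
    using kernel_meets_orthogonal_complement[OF M Uc] by blast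
  have "\<forall>i\<in>{1..m}. a i \<bullet> z = 0"
    using orthogonal_to_span[OF Uc(1) z(1,4)] U(3) by blast
  with z show ?thesis
    unfolding NewDC_iff_common_null_vector[OF n Q a] by blast
qed

theorem theorem4:
  fixes n m :: nat and Q :: "real mat" and c :: "real vec"
    and a :: "nat \<Rightarrow> real vec" and b :: "nat \<Rightarrow> real"
  assumes "n \<ge> 1"
    and "Q \<in> carrier_mat n n" and "Q\<^sup>T = Q"
    and "lambda_min Q < 0"
    and "c \<in> carrier_vec n"
    and "\<forall>i\<in>{1..m}. a i \<in> carrier_vec n"
  shows "(NewDC n m Q a \<longrightarrow> tr_value n m Q c a b = sdp_value n m Q c a b) \<and>
         (DC n m Q a \<longrightarrow> NewDC n m Q a)"
proof (intro conjI impI)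
  assume "NewDC n m Q a"
  then obtain z where z: "z \<in> carrier_vec n" "z \<noteq> 0\<^sub>v n" "shifted_mat n Q *\<^sub>v z = 0\<^sub>v n"
    "\<forall>i\<in>{1..m}. a i \<bullet> z = 0"
    using NewDC_iff_common_null_vector[OF assms(1-3,6)] by blast
  show "tr_value n m Q c a b = sdp_value n m Q c a b"
    using tr_value_le_sdp_value[OF assms z] sdp_value_le_tr_value[OF assms(2)] by (rule antisym)
next
  assume "DC n m Q a"
  then show "NewDC n m Q a"
    by (rule DC_imp_NewDC[OF assms(1-3,6)])
qed

end
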